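(* Let $K$ be an algebraically closed field of characteristic $\neq 2$ and let $f(x_1,\dots,x_m)$ be any Lie polynomial over $K$ (not necessarily homogeneous), evaluated on $\operatorname{sl}_2(K)$. Then the image $\operatorname{Im} f=\{f(a_1,\dots,a_m): a_1,\dots,a_m\in \operatorname{sl}_2(K)\}$ is one of: $\operatorname{sl}_2(K)$; or $\{0\}$; or the set of all trace zero non-nilpotent matrices in $M_2(K)$ together with $0$.
   Context: A Lie polynomial over $K$ is an element of the free Lie algebra over $K$ in letters $x_1,x_2,\dots$; it is evaluated on matrices by interpreting the bracket as $[a,b]=ab-ba$. $\operatorname{sl}_2(K)$ denotes the Lie algebra of all $2\times 2$ matrices over $K$ of trace $0$. *)

theory Defs
  imports "HOL-Analysis.Analysis"
begin

section \<open>The free Lie algebra\<close>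

text \<open>
  The free Lie algebra over \<open>'k\<close> in letters \<open>x\<^sub>0, x\<^sub>1, x\<^sub>2, \<dots>\<close>: formal Lie expressions
  modulo the least congruence that contains the axioms of a Lie algebra over a field.
  The Lie axiom used is \<open>[u, u] = 0\<close>, which is the right one in every characteristic.
  Letters are indexed by all natural numbers; the letter with index \<open>0\<close> is never used below.
\<close>

datatype 'k lie_expr =
    Letter nat
  | Zero
  | Add "'k lie_expr" "'k lie_expr"
  | Scale 'k "'k lie_expr"
  | Bracket "'k lie_expr" "'k lie_expr"

inductive lie_eq :: "'k::field lie_expr \<Rightarrow> 'k lie_expr \<Rightarrow> bool" where
  refl: "lie_eq u u"
| sym: "lie_eq u v \<Longrightarrow> lie_eq v u"
| trans: "lie_eq u v \<Longrightarrow> lie_eq v w \<Longrightarrow> lie_eq u w"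
| cong_add: "lie_eq u u' \<Longrightarrow> lie_eq v v' \<Longrightarrow> lie_eq (Add u v) (Add u' v')"
| cong_scale: "lie_eq u u' \<Longrightarrow> lie_eq (Scale c u) (Scale c u')"
| cong_bracket: "lie_eq u u' \<Longrightarrow> lie_eq v v' \<Longrightarrow> lie_eq (Bracket u v) (Bracket u' v')"
| add_assoc: "lie_eq (Add (Add u v) w) (Add u (Add v w))"
| add_commute: "lie_eq (Add u v) (Add v u)"
| add_zero: "lie_eq (Add Zero u) u"
| add_neg: "lie_eq (Add (Scale (- 1) u) u) Zero"
| scale_add_right: "lie_eq (Scale c (Add u v)) (Add (Scale c u) (Scale c v))"
| scale_add_left: "lie_eq (Scale (c + d) u) (Add (Scale c u) (Scale d u))"
| scale_scale: "lie_eq (Scale c (Scale d u)) (Scale (c * d) u)"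
| scale_one: "lie_eq (Scale 1 u) u"
| bracket_add_left: "lie_eq (Bracket (Add u v) w) (Add (Bracket u w) (Bracket v w))"
| bracket_add_right: "lie_eq (Bracket u (Add v w)) (Add (Bracket u v) (Bracket u w))"
| bracket_scale_left: "lie_eq (Bracket (Scale c u) v) (Scale c (Bracket u v))"
| bracket_scale_right: "lie_eq (Bracket u (Scale c v)) (Scale c (Bracket u v))"
| bracket_self: "lie_eq (Bracket u u) Zero"
| jacobi: "lie_eq (Add (Bracket u (Bracket v w))
                     (Add (Bracket v (Bracket w u)) (Bracket w (Bracket u v)))) Zero"

quotient_type (overloaded) 'k free_lie = "'k::field lie_expr" / lie_eq
  by (intro equivpI reflpI sympI transpI) (blast intro: lie_eq.refl lie_eq.sym lie_eq.trans)+

instantiation free_lie :: (field) ab_group_add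
begin

lift_definition zero_free_lie :: "'a free_lie" is Zero .

lift_definition plus_free_lie :: "'a free_lie \<Rightarrow> 'a free_lie \<Rightarrow> 'a free_lie" is Add
  by (rule lie_eq.cong_add)

lift_definition uminus_free_lie :: "'a free_lie \<Rightarrow> 'a free_lie" is "Scale (- 1)"
  by (rule lie_eq.cong_scale)

definition minus_free_lie :: "'a free_lie \<Rightarrow> 'a free_lie \<Rightarrow> 'a free_lie" where
  "minus_free_lie u v = u + (- v)"

instance
proof
  fix a b c :: "'a free_lie"
  show "a + b + c = a + (b + c)" by transfer (rule lie_eq.add_assoc)
  show "a + b = b + a" by transfer (rule lie_eq.add_commute)
  show "0 + a = a" by transfer (rule lie_eq.add_zero)
  show "- a + a = 0" by transfer (rule lie_eq.add_neg)
  show "a - b = a + (- b)" by (rule minus_free_lie_def)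
qed

end

lift_definition letter :: "nat \<Rightarrow> 'k::field free_lie" is Letter .

lift_definition lie_scale :: "'k::field \<Rightarrow> 'k free_lie \<Rightarrow> 'k free_lie" is Scale
  by (rule lie_eq.cong_scale)

lift_definition lie_bracket :: "'k::field free_lie \<Rightarrow> 'k free_lie \<Rightarrow> 'k free_lie" is Bracket
  by (rule lie_eq.cong_bracket)

lemma vector_space_lie_scale: "vector_space (lie_scale :: 'k::field \<Rightarrow> _)"
proof
  fix a b :: 'k and x y :: "'k free_lie"
  show "lie_scale a (x + y) = lie_scale a x + lie_scale a y"
    by transfer (rule lie_eq.scale_add_right)
  show "lie_scale (a + b) x = lie_scale a x + lie_scale b x"
    by transfer (rule lie_eq.scale_add_left)
  show "lie_scale a (lie_scale b x) = lie_scale (a * b) x"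
    by transfer (rule lie_eq.scale_scale)
  show "lie_scale 1 x = x"
    by transfer (rule lie_eq.scale_one)
qed

lemma lie_bracket_bilinear:
  "lie_bracket (u + v) w = lie_bracket u w + lie_bracket v w"
  "lie_bracket u (v + w) = lie_bracket u v + lie_bracket u w"
  "lie_bracket (lie_scale c u) v = lie_scale c (lie_bracket u v)"
  "lie_bracket u (lie_scale c v) = lie_scale c (lie_bracket u v)"
  by (transfer, rule lie_eq.bracket_add_left lie_eq.bracket_add_right
      lie_eq.bracket_scale_left lie_eq.bracket_scale_right)+

lemma lie_bracket_self: "lie_bracket u u = 0"
  by transfer (rule lie_eq.bracket_self)

lemma lie_bracket_jacobi:
  "lie_bracket u (lie_bracket v w) + (lie_bracket v (lie_bracket w u)
     + lie_bracket w (lie_bracket u v)) = 0"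
  by transfer (rule lie_eq.jacobi)

text \<open>
  The Lie polynomials \<open>f(x\<^sub>1, \<dots>, x\<^sub>m)\<close>: the Lie subalgebra generated by \<open>x\<^sub>1, \<dots>, x\<^sub>m\<close>.
\<close>

inductive_set lie_polynomials :: "nat \<Rightarrow> 'k::field free_lie set" for m :: nat where
  letter: "i \<in> {1..m} \<Longrightarrow> letter i \<in> lie_polynomials m"
| zero: "0 \<in> lie_polynomials m"
| add: "u \<in> lie_polynomials m \<Longrightarrow> v \<in> lie_polynomials m \<Longrightarrow> u + v \<in> lie_polynomials m"
| scale: "u \<in> lie_polynomials m \<Longrightarrow> lie_scale c u \<in> lie_polynomials m"
| bracket: "u \<in> lie_polynomials m \<Longrightarrow> v \<in> lie_polynomials m \<Longrightarrow>
    lie_bracket u v \<in> lie_polynomials m"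


section \<open>Evaluation on matrices\<close>

text \<open>
  Matrix multiplication is \<open>**\<close>; the operations \<open>*\<close> and \<open>^\<close> that the type of vectors
  inherits from the type classes act entrywise and are not the ones wanted here.
\<close>

definition commutator :: "'k::ring_1^'n^'n \<Rightarrow> 'k^'n^'n \<Rightarrow> 'k^'n^'n" where
  "commutator A B = A ** B - B ** A"

definition nilpotent_matrix :: "'k::semiring_1^'n^'n \<Rightarrow> bool" where
  "nilpotent_matrix A \<longleftrightarrow> (\<exists>n. (((**) A) ^^ n) (mat 1) = 0)"

definition sl2 :: "('k::field^2^2) set" where
  "sl2 = {A. trace A = 0}"

primrec lie_expr_eval :: "(nat \<Rightarrow> 'k::field^'n^'n) \<Rightarrow> 'k lie_expr \<Rightarrow> 'k^'n^'n" where
  "lie_expr_eval a (Letter i) = a i"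
| "lie_expr_eval a Zero = 0"
| "lie_expr_eval a (Add u v) = lie_expr_eval a u + lie_expr_eval a v"
| "lie_expr_eval a (Scale c u) = map_matrix ((*) c) (lie_expr_eval a u)"
| "lie_expr_eval a (Bracket u v) = commutator (lie_expr_eval a u) (lie_expr_eval a v)"

lemma map_matrix_mult_left:
  "map_matrix ((*) c) A ** B = map_matrix ((*) (c::'k::field)) (A ** B)"
  by (simp add: vec_eq_iff matrix_matrix_mult_def sum_distrib_left mult.assoc)

lemma map_matrix_mult_right:
  "A ** map_matrix ((*) c) B = map_matrix ((*) (c::'k::field)) (A ** B)"
  by (simp add: vec_eq_iff matrix_matrix_mult_def sum_distrib_left mult.left_commute)

lemma matrix_add_rdistrib: "(A + B) ** C = A ** C + B ** (C :: 'k::ring_1^'n^'m)"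
  by (simp add: vec_eq_iff matrix_matrix_mult_def distrib_right sum.distrib)

lemma matrix_diff_ldistrib: "A ** (B - C) = A ** B - A ** (C :: 'k::ring_1^'n^'m)"
  by (simp add: vec_eq_iff matrix_matrix_mult_def right_diff_distrib sum_subtractf)

lemma matrix_diff_rdistrib: "(A - B) ** C = A ** C - B ** (C :: 'k::ring_1^'n^'m)"
  by (simp add: vec_eq_iff matrix_matrix_mult_def left_diff_distrib sum_subtractf)

lemma lie_eq_imp_lie_expr_eval_eq:
  "lie_eq u v \<Longrightarrow> lie_expr_eval a u = lie_expr_eval a v"
proof (induction rule: lie_eq.induct)
  case (cong_bracket u u' v v')
  then show ?case by simp
next
  case (bracket_add_left u v w)
  then show ?case
    by (simp add: commutator_def matrix_add_ldistrib matrix_add_rdistrib)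
next
  case (bracket_add_right u v w)
  then show ?case
    by (simp add: commutator_def matrix_add_ldistrib matrix_add_rdistrib)
next
  case (bracket_scale_left c u v)
  then show ?case
    by (simp add: commutator_def map_matrix_mult_left map_matrix_mult_right vec_eq_iff
        right_diff_distrib)
next
  case (bracket_scale_right u c v)
  then show ?case
    by (simp add: commutator_def map_matrix_mult_left map_matrix_mult_right vec_eq_iff
        right_diff_distrib)
next
  case (jacobi u v w)
  then show ?case
    by (simp add: commutator_def matrix_diff_ldistrib matrix_diff_rdistrib matrix_mul_assoc)
qed (simp_all add: commutator_def vec_eq_iff algebra_simps)

text \<open>
  The Lie homomorphism \<open>f \<mapsto> f(a\<^sub>1, a\<^sub>2, \<dots>)\<close> that sends the letter \<open>x\<^sub>i\<close> to the matrix \<open>a\<^sub>i\<close>.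
\<close>

lift_definition lie_eval ::
  "(nat \<Rightarrow> 'k::field^'n^'n) \<Rightarrow> 'k free_lie \<Rightarrow> 'k^'n^'n" is lie_expr_eval
  by (rule lie_eq_imp_lie_expr_eval_eq)

lemma lie_eval_simps [simp]:
  "lie_eval a (letter i) = a i"
  "lie_eval a 0 = 0"
  "lie_eval a (u + v) = lie_eval a u + lie_eval a v"
  "lie_eval a (lie_scale c u) = map_matrix ((*) c) (lie_eval a u)"
  "lie_eval a (lie_bracket u v) = commutator (lie_eval a u) (lie_eval a v)"
  by (transfer, simp)+

lemma lie_eval_cong:
  assumes "f \<in> lie_polynomials m" and "\<And>i. i \<in> {1..m} \<Longrightarrow> a i = b i"
  shows "lie_eval a f = lie_eval b f"
  using assms by induction simp_all

text \<open>
  Only \<open>a\<^sub>1, \<dots>, a\<^sub>m\<close> are constrained in the image: for \<open>f \<in> lie_polynomials m\<close> the remaining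
  values of \<open>a\<close> are irrelevant by the preceding lemma.
\<close>

definition lie_image :: "nat \<Rightarrow> 'k::field free_lie \<Rightarrow> ('k^2^2) set" where
  "lie_image m f = {lie_eval a f | a. \<forall>i\<in>{1..m}. a i \<in> sl2}"

end

theory Submission
  imports Defs
begin

text \<open>
  All nonzero trace zero \<open>2 \<times> 2\<close> matrices with the same determinant are conjugate, and the image
  of \<open>f\<close> is closed under conjugation, so the image is determined by the values of \<open>det \<circ> f\<close> and by
  whether it contains a nonzero nilpotent matrix. Restricted to a line through the origin, \<open>det \<circ> f\<close>
  is a polynomial in one variable vanishing at \<open>0\<close>; hence \<open>det \<circ> f\<close> is surjective unless it is
  identically zero.

  In the latter case \<open>f\<close> vanishes. Indeed, evaluate \<open>f\<close> on combinations, with coefficients in \<open>K\<close>,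
  of the standard basis \<open>i, j, ij\<close> of the pure quaternions with \<open>i\<^sup>2 = s\<close> and \<open>j\<^sup>2 = t\<close>.
  The value is \<open>Y i + Z j + W ij\<close> with \<open>Y, Z, W \<in> K[s, t]\<close>, and \<open>det f = 0\<close> says that
  \<open>s Y\<^sup>2 + t Z\<^sup>2 = s t W\<^sup>2\<close>. The three terms have leading monomials with different parities of
  the exponents, so \<open>Y = Z = W = 0\<close>. Specializing to \<open>s = t = 1\<close> gives all values of \<open>f\<close>.
\<close>

section \<open>Polynomials and norm forms\<close>

text \<open>Over a finite field, the product of all \<open>X - a\<close> plus 1 would be a
  nonconstant polynomial without roots.\<close>

lemma infinite_UNIV_alg_closed_field: "infinite (UNIV :: 'k::alg_closed_field set)"
proof
  assume fin: "finite (UNIV :: 'k set)"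
  let ?q = "(\<Prod>a\<in>UNIV. [:- a, 1:]) :: 'k poly"
  have "degree ?q = card (UNIV :: 'k set)"
    by (subst degree_prod_sum_eq) auto
  moreover have "card (UNIV :: 'k set) > 0"
    using fin by (simp add: card_gt_0_iff)
  ultimately have "degree (?q + 1) > 0"
    by (metis degree_1 degree_add_eq_left)
  then obtain x where "poly (?q + 1) x = 0"
    using alg_closed_imp_poly_has_root by blast
  moreover have "poly ?q x = 0"
    using fin by (auto simp: poly_prod intro!: bexI[of _ x])
  ultimately show False
    by simp
qed

lemma poly_eq_0_if_infinite_roots:
  fixes p :: "'a::idom poly"
  assumes "infinite S" "\<And>x. x \<in> S \<Longrightarrow> poly p x = 0"
  shows "p = 0"
  using assms poly_roots_finite[of p] by (metis (mono_tags) finite_subset mem_Collect_eq subsetI)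

text \<open>With the outer value \<open>t\<close> fixed, infinitely many \<open>s\<close> force
  \<open>poly P [:t:] = 0\<close>; so \<open>P\<close> itself has infinitely many constants
  \<open>[:t:]\<close> as roots.\<close>

lemma poly_poly_eq_0:
  fixes P :: "'k::field poly poly"
  assumes "infinite (UNIV :: 'k set)" and "\<And>s t. poly (poly P [:t:]) s = 0"
  shows "P = 0"
proof (rule poly_eq_0_if_infinite_roots)
  show "infinite (range (\<lambda>t::'k. [:t:]))"
    using assms(1) by (simp add: finite_image_iff inj_on_def)
  fix x :: "'k poly" assume "x \<in> range (\<lambda>t. [:t:])"
  then show "poly P x = 0"
    using assms(2) by (auto intro: poly_eq_0_if_infinite_roots[OF assms(1)])
qed

text \<open>A bound \<open>n\<close> replaces the degree so that two polynomials can share one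
  \<open>n\<close>; above the degree both sides vanish.\<close>

lemma coeff_square_double:
  fixes p :: "'a::idom poly"
  assumes "degree p \<le> n"
  shows "coeff (p ^ 2) (2 * n) = coeff p n ^ 2"
proof (cases "degree p = n")
  case True
  then show ?thesis
    using coeff_mult_degree_sum[of p p] by (simp add: power2_eq_square mult_2)
next
  case False
  moreover have "degree (p ^ 2) \<le> 2 * degree p"
    by (metis degree_power_le mult.commute)
  ultimately show ?thesis
    using assms by (simp add: coeff_eq_0)
qed

text \<open>For nonzero \<open>w\<close> the left side has odd degree, whereas a nonzero square has
  even degree.\<close>

lemma X_times_square_eq_square:
  fixes w z :: "'a::idom poly"
  assumes "[:0, 1:] * w ^ 2 = z ^ 2"
  shows "w = 0 \<and> z = 0"
proof (cases "w = 0")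
  case False
  then have deg: "degree ([:0, 1:] * w ^ 2) = 1 + 2 * degree w"
    by (subst degree_mult_eq) (auto simp: degree_power_eq)
  moreover have "z \<noteq> 0"
    using assms False by auto
  then have "degree (z ^ 2) = 2 * degree z"
    by (simp add: degree_power_eq)
  ultimately have "1 + 2 * degree w = 2 * degree z"
    using deg unfolding assms by metis
  then show ?thesis
    by presburger
next
  case True
  then show ?thesis
    using assms by auto
qed

text \<open>The first hypothesis says that \<open>s\<close> is not a square in the fraction field.
  Writing X for the variable, the equation becomes \<open>s Y^2 = X (s W^2 - Z^2)\<close>, with even
  degree on the left and odd degree on the right.\<close>

lemma pure_norm_form_anisotropic:
  fixes Y Z W :: "'a::idom poly" and s :: 'a
  assumes s: "\<And>w z. s * w ^ 2 = z ^ 2 \<Longrightarrow> w = 0 \<and> z = 0"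
    and eq: "smult s (Y ^ 2) + [:0, 1:] * Z ^ 2 = [:0, 1:] * smult s (W ^ 2)"
  shows "Y = 0 \<and> Z = 0 \<and> W = 0"
proof -
  define D where "D = smult s (W ^ 2) - Z ^ 2"
  have "s \<noteq> 0"
    using s[of 1 0] by auto
  have D: "smult s (Y ^ 2) = [:0, 1:] * D"
    using eq unfolding D_def right_diff_distrib by (metis add_diff_cancel_right')
  show ?thesis
  proof (cases "W = 0 \<and> Z = 0")
    case True
    then show ?thesis
      using D \<open>s \<noteq> 0\<close> by (simp add: D_def)
  next
    case False
    define n where "n = max (degree W) (degree Z)"
    have n: "degree W \<le> n" "degree Z \<le> n"
      by (simp_all add: n_def)
    \<comment> \<open>The top terms of \<open>s W^2\<close> and \<open>Z^2\<close> cannot cancel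
      because \<open>s\<close> is not a square, so \<open>D\<close> has even degree.\<close>
    have "coeff D (2 * n) = s * coeff W n ^ 2 - coeff Z n ^ 2"
      using n by (simp add: D_def coeff_square_double)
    moreover have "coeff W n \<noteq> 0 \<or> coeff Z n \<noteq> 0"
      using False n by (metis leading_coeff_neq_0 max_def n_def degree_0 le_zero_eq)
    ultimately have nz: "coeff D (2 * n) \<noteq> 0"
      using s by auto
    have "degree (W ^ 2) \<le> 2 * n" "degree (Z ^ 2) \<le> 2 * n"
      using n degree_power_le[of W 2] degree_power_le[of Z 2] by linarith+
    then have "degree D \<le> 2 * n"
      unfolding D_def by (intro degree_diff_le order.trans[OF degree_smult_le])
    then have "degree D = 2 * n"
      using le_degree[OF nz] by (rule antisym)
    moreover have "D \<noteq> 0"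
      using nz by auto
    ultimately have "degree ([:0, 1:] * D) = 1 + 2 * n"
      by (subst degree_mult_eq) auto
    moreover have "degree (smult s (Y ^ 2)) = 2 * degree Y"
      using \<open>s \<noteq> 0\<close> by (cases "Y = 0") (simp_all add: degree_power_eq)
    ultimately have "1 + 2 * n = 2 * degree Y"
      using D by simp
    then show ?thesis
      by presburger
  qed
qed

section \<open>Trace zero matrices of size two\<close>

lemma matrix2_eq_iff:
  "A = (B :: 'a^2^2) \<longleftrightarrow>
     A$1$1 = B$1$1 \<and> A$1$2 = B$1$2 \<and> A$2$1 = B$2$1 \<and> A$2$2 = B$2$2"
  by (auto simp: vec_eq_iff forall_2)

lemma trace_2: "trace (A :: 'a::semiring_1^2^2) = A$1$1 + A$2$2"
  by (simp add: trace_def sum_2)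

lemmas matrix2_simps = matrix2_eq_iff trace_2 det_2 matrix_matrix_mult_def sum_2 mat_def

definition mat2 :: "'a \<Rightarrow> 'a \<Rightarrow> 'a \<Rightarrow> 'a \<Rightarrow> 'a^2^2" where
  "mat2 a b c d = (\<chi> i j. if i = 1 then if j = 1 then a else b else if j = 1 then c else d)"

lemma mat2_nth [simp]:
  "mat2 a b c d $ 1 $ 1 = a" "mat2 a b c d $ 1 $ 2 = b"
  "mat2 a b c d $ 2 $ 1 = c" "mat2 a b c d $ 2 $ 2 = d"
  by (simp_all add: mat2_def)

lemma two_neq_0:
  assumes "CHAR('k::idom) \<noteq> 2"
  shows "(2 :: 'k) \<noteq> 0"
proof
  assume "(2 :: 'k) = 0"
  then have "of_nat 2 = (0 :: 'k)"
    by simp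
  then have "CHAR('k) dvd 2"
    by (simp only: of_nat_eq_0_iff_char_dvd)
  then show False
    using assms CHAR_not_1' by (metis prime_nat_iff two_is_prime_nat One_nat_def)
qed

text \<open>The determinant is multiplicative; conversely, Cayley-Hamilton gives
  \<open>A^2 = - det A\<close> when the trace is 0.\<close>

lemma nilpotent_matrix_iff_det:
  fixes A :: "'k::field^2^2"
  assumes "trace A = 0"
  shows "nilpotent_matrix A \<longleftrightarrow> det A = 0"
proof
  assume "nilpotent_matrix A"
  then obtain n where "((**) A ^^ n) (mat 1) = 0"
    unfolding nilpotent_matrix_def by blast
  moreover have "det (((**) A ^^ n) (mat 1)) = det A ^ n" for n
    by (induction n) (simp_all add: det_mul)
  ultimately have "det A ^ n = 0"
    by (metis det_0 mat_0)
  then show "det A = 0"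
    by simp
next
  assume "det A = 0"
  moreover have "A$2$2 = - A$1$1"
    using assms by (simp add: trace_2 add_eq_0_iff)
  ultimately have "A ** A = 0"
    by (simp add: matrix2_simps algebra_simps) algebra
  then have "((**) A ^^ 2) (mat 1) = 0"
    by (simp add: numeral_2_eq_2)
  then show "nilpotent_matrix A"
    unfolding nilpotent_matrix_def by blast
qed

text \<open>For a vector v that is not an eigenvector, v and Av form a basis, in which
  \<open>A\<close> is the companion matrix of \<open>X^2 + det A\<close>.\<close>

lemma similar_companion:
  fixes A :: "'k::field^2^2"
  assumes two: "(2 :: 'k) \<noteq> 0" and "trace A = 0" "A \<noteq> 0"
  obtains P Q where "P ** Q = mat 1" "Q ** P = mat 1"
    "A = P ** mat2 0 (- det A) 1 0 ** Q"
proof -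
  define a b c where "a = A$1$1" and "b = A$1$2" and "c = A$2$1"
  have A: "A = mat2 a b c (- a)"
    using assms(2) by (simp add: matrix2_eq_iff trace_2 a_def b_def c_def add_eq_0_iff)
  \<comment> \<open>The expression is the determinant with columns v = (x, y) and Av. If
    \<open>A\<close> is diag(a, -a), then v = (1, 1) gives -2a, which is nonzero as 2 is.\<close>
  obtain x y where xy: "x * (c * x - a * y) - y * (a * x + b * y) \<noteq> 0"
  proof -
    consider "c \<noteq> 0" | "b \<noteq> 0" | "b = 0" "c = 0" "a \<noteq> 0"
      using assms(3) A by (fastforce simp: matrix2_eq_iff)
    then show ?thesis
    proof cases
      case 1
      then show ?thesis using that[of 1 0] by simp
    next
      case 2
      then show ?thesis using that[of 0 1] by simp
    next
      case 3
      then have "- (2 * a) \<noteq> 0" using two by simp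
      then show ?thesis using that[of 1 1] 3 by (simp add: algebra_simps)
    qed
  qed
  define P where "P = mat2 x (a * x + b * y) y (c * x - a * y)"
  have "det P \<noteq> 0"
    using xy by (simp add: det_2 P_def algebra_simps)
  then obtain Q where Q: "P ** Q = mat 1" "Q ** P = mat 1"
    using invertible_det_nz[of P] unfolding invertible_def by blast
  have "A ** P = P ** mat2 0 (- det A) 1 0"
    by (simp add: A P_def matrix2_simps algebra_simps)
  then have "A = P ** mat2 0 (- det A) 1 0 ** Q"
    using Q(1) by (metis matrix_mul_assoc matrix_mul_rid)
  then show ?thesis
    using that Q by blast
qed

lemma trace_0_similar:
  fixes A B :: "'k::field^2^2"
  assumes "(2 :: 'k) \<noteq> 0" "trace A = 0" "A \<noteq> 0" "trace B = 0" "B \<noteq> 0" "det A = det B"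
  obtains P Q where "Q ** P = mat 1" "B = P ** A ** Q"
proof -
  let ?C = "mat2 0 (- det A) 1 0"
  obtain P Q where PQ: "P ** Q = mat 1" "Q ** P = mat 1" "A = P ** ?C ** Q"
    using similar_companion[OF assms(1-3)] .
  obtain R S where RS: "R ** S = mat 1" "S ** R = mat 1" "B = R ** ?C ** S"
    using similar_companion[OF assms(1,4,5)] assms(6) by metis
  have "Q ** A ** P = ?C"
    by (metis PQ matrix_mul_assoc matrix_mul_lid matrix_mul_rid)
  then have "B = (R ** Q) ** A ** (P ** S)"
    by (metis RS(3) matrix_mul_assoc)
  moreover have "(P ** S) ** (R ** Q) = mat 1"
    by (metis PQ(1) RS(2) matrix_mul_assoc matrix_mul_rid)
  ultimately show ?thesis
    using that by blast
qed

section \<open>Evaluation of Lie polynomials\<close>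

lemma trace_commutator: "trace (commutator A (B :: 'k::field^'n^'n)) = 0"
  by (simp add: commutator_def trace_sub trace_mul_sym[of A])

lemma trace_map_matrix_mult: "trace (map_matrix ((*) c) A) = c * trace (A :: 'k::field^'n^'n)"
  by (simp add: trace_def sum_distrib_left)

lemma lie_eval_trace_0:
  fixes a :: "nat \<Rightarrow> 'k::field^'n^'n"
  assumes "f \<in> lie_polynomials m" "\<And>i. i \<in> {1..m} \<Longrightarrow> trace (a i) = 0"
  shows "trace (lie_eval a f) = 0"
  using assms
  by induction (simp_all add: trace_add trace_map_matrix_mult trace_commutator, simp add: trace_def)

text \<open>Conjugation respects products, hence commutators: the inner factor \<open>Q ** P\<close>
  cancels.\<close>

lemma lie_eval_conjugate:
  fixes a :: "nat \<Rightarrow> 'k::field^'n^'n"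
  assumes "f \<in> lie_polynomials m" and QP: "Q ** P = mat 1"
  shows "lie_eval (\<lambda>i. P ** a i ** Q) f = P ** lie_eval a f ** Q"
  using assms(1)
proof induction
  case (bracket u v)
  have "(P ** A ** Q) ** (P ** B ** Q) = P ** (A ** B) ** Q" for A B
    by (metis QP matrix_mul_assoc matrix_mul_rid)
  with bracket show ?case
    by (simp add: commutator_def matrix_diff_ldistrib matrix_diff_rdistrib)
qed (simp_all add: matrix_add_ldistrib matrix_add_rdistrib map_matrix_mult_left
    map_matrix_mult_right)

lemma trace_conjugate:
  fixes A :: "'k::field^'n^'n"
  assumes "Q ** P = mat 1"
  shows "trace (P ** A ** Q) = trace A"
  by (metis assms matrix_mul_assoc matrix_mul_lid trace_mul_sym)

lemma lie_image_conjugate: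
  assumes f: "f \<in> lie_polynomials m" and "A \<in> lie_image m f" and QP: "Q ** P = mat 1"
  shows "P ** A ** Q \<in> lie_image m f"
proof -
  obtain a where a: "A = lie_eval a f" "\<forall>i\<in>{1..m}. a i \<in> sl2"
    using assms(2) unfolding lie_image_def by blast
  have "P ** A ** Q = lie_eval (\<lambda>i. P ** a i ** Q) f"
    using lie_eval_conjugate[OF f QP] a by simp
  moreover have "\<forall>i\<in>{1..m}. P ** a i ** Q \<in> sl2"
    using a(2) by (simp add: sl2_def trace_conjugate[OF QP])
  ultimately show ?thesis
    unfolding lie_image_def by blast
qed

lemma lie_eval_at_0:
  assumes "f \<in> lie_polynomials m"
  shows "lie_eval (\<lambda>_. 0) f = (0 :: 'k::field^'n^'n)"
  using assms by induction (simp_all add: commutator_def, simp add: vec_eq_iff)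

lemma zero_in_lie_image:
  assumes "f \<in> lie_polynomials m"
  shows "0 \<in> lie_image m f"
  unfolding lie_image_def sl2_def
  using lie_eval_at_0[OF assms] by (auto simp: trace_2 intro!: exI[of _ "\<lambda>_. 0"])

lemma lie_image_subset_sl2:
  assumes "f \<in> lie_polynomials m"
  shows "lie_image m f \<subseteq> sl2"
  using lie_eval_trace_0[OF assms] by (fastforce simp: lie_image_def sl2_def)

lemma map_matrix_poly_mult:
  "map_matrix (\<lambda>p. poly p l) (A ** B) =
     map_matrix (\<lambda>p. poly p l) A ** map_matrix (\<lambda>p. poly p (l :: 'k::field)) B"
  by (simp add: vec_eq_iff matrix_matrix_mult_def poly_sum)

lemma map_matrix_poly_diff:
  "map_matrix (\<lambda>p. poly p l) (A - B) =
     map_matrix (\<lambda>p. poly p l) A - map_matrix (\<lambda>p. poly p (l :: 'k::field)) B"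
  by (simp add: vec_eq_iff)

text \<open>As \<open>f\<close> may be inhomogeneous, scaling the arguments does not just multiply
  the value by a power of \<open>l\<close>; polynomial dependence on \<open>l\<close> is what
  survives.\<close>

lemma lie_eval_line:
  fixes a :: "nat \<Rightarrow> 'k::field^'n^'n"
  assumes "f \<in> lie_polynomials m"
  shows "\<exists>P. \<forall>l. lie_eval (\<lambda>i. map_matrix ((*) l) (a i)) f = map_matrix (\<lambda>p. poly p l) P"
  using assms
proof induction
  case (letter i)
  show ?case
    by (rule exI[of _ "map_matrix (\<lambda>c. [:0, c:]) (a i)"]) (simp add: vec_eq_iff)
next
  case zero
  show ?case
    by (rule exI[of _ 0]) (simp add: vec_eq_iff)
next
  case (add u v)
  then obtain P Q where
    "\<forall>l. lie_eval (\<lambda>i. map_matrix ((*) l) (a i)) u = map_matrix (\<lambda>p. poly p l) P"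
    "\<forall>l. lie_eval (\<lambda>i. map_matrix ((*) l) (a i)) v = map_matrix (\<lambda>p. poly p l) Q"
    by blast
  then show ?case
    by (intro exI[of _ "P + Q"]) (simp add: vec_eq_iff)
next
  case (scale u c)
  then obtain P where
    "\<forall>l. lie_eval (\<lambda>i. map_matrix ((*) l) (a i)) u = map_matrix (\<lambda>p. poly p l) P"
    by blast
  then show ?case
    by (intro exI[of _ "map_matrix (smult c) P"]) (simp add: vec_eq_iff)
next
  case (bracket u v)
  then obtain P Q where
    "\<forall>l. lie_eval (\<lambda>i. map_matrix ((*) l) (a i)) u = map_matrix (\<lambda>p. poly p l) P"
    "\<forall>l. lie_eval (\<lambda>i. map_matrix ((*) l) (a i)) v = map_matrix (\<lambda>p. poly p l) Q"
    by blast
  then show ?case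
    by (intro exI[of _ "P ** Q - Q ** P"])
      (simp add: commutator_def map_matrix_poly_mult[symmetric] map_matrix_poly_diff)
qed

lemma det_surj_on_lie_image:
  fixes f :: "'k::alg_closed_field free_lie"
  assumes f: "f \<in> lie_polynomials m" and "A \<in> lie_image m f" "det A \<noteq> 0"
  obtains B where "B \<in> lie_image m f" "det B = d"
proof -
  obtain a where a: "A = lie_eval a f" "\<forall>i\<in>{1..m}. a i \<in> sl2"
    using assms(2) unfolding lie_image_def by blast
  let ?a = "\<lambda>l i. map_matrix ((*) l) (a i)"
  obtain P where P: "\<And>l. lie_eval (?a l) f = map_matrix (\<lambda>p. poly p l) P"
    using lie_eval_line[OF f] by blast
  have det: "det (lie_eval (?a l) f) = poly (det P) l" for l
    by (simp add: P det_2)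
  \<comment> \<open>The line joins 0, where the determinant is 0, to \<open>a\<close>, where it is
    nonzero. Hence \<open>det P\<close> is nonconstant and takes the value \<open>d\<close>.\<close>
  have "?a 1 = a" "?a 0 = (\<lambda>_. 0)"
    by (simp_all add: vec_eq_iff fun_eq_iff)
  then have "poly (det P) 1 \<noteq> 0" "poly (det P) 0 = 0"
    using det[of 1] det[of 0] a(1) assms(3) lie_eval_at_0[OF f]
    by (metis, metis det_0 mat_0)
  then have "degree (det P) \<noteq> 0"
    by (metis degree_eq_zeroE poly_pCons poly_0 mult_zero_right add.right_neutral)
  then have "degree (det P - [:d:]) > 0"
    by (metis bot_nat_0.not_eq_extremum degree_add_eq_left degree_minus degree_pCons_0 diff_conv_add_uminus)
  then obtain l where "poly (det P - [:d:]) l = 0"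
    using alg_closed_imp_poly_has_root by blast
  then have "det (lie_eval (?a l) f) = d"
    by (simp add: det)
  moreover have "\<forall>i\<in>{1..m}. ?a l i \<in> sl2"
    using a(2) by (simp add: sl2_def trace_map_matrix_mult)
  then have "lie_eval (?a l) f \<in> lie_image m f"
    unfolding lie_image_def by blast
  ultimately show ?thesis
    using that by blast
qed

section \<open>Evaluation on pure quaternions\<close>

text \<open>
  The pure quaternion \<open>y i + z j + w ij\<close> with \<open>i = diag(r, -r)\<close> and \<open>j\<close> the matrix with rows
  \<open>(0, t)\<close> and \<open>(1, 0)\<close>, so that \<open>i\<^sup>2 = r\<^sup>2\<close> and \<open>j\<^sup>2 = t\<close>.
\<close>

definition quat :: "'k::field \<Rightarrow> 'k \<Rightarrow> 'k \<Rightarrow> 'k \<Rightarrow> 'k \<Rightarrow> 'k^2^2" where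
  "quat r t y z w = mat2 (y * r) (t * (z + w * r)) (z - w * r) (- (y * r))"

lemma quat_add: "quat r t y z w + quat r t y' z' w' = quat r t (y + y') (z + z') (w + w')"
  by (simp add: quat_def matrix2_eq_iff algebra_simps)

lemma quat_scale: "map_matrix ((*) c) (quat r t y z w) = quat r t (c * y) (c * z) (c * w)"
  by (simp add: quat_def matrix2_eq_iff algebra_simps)

text \<open>From ij = -ji: [i, j] = 2ij, [j, ij] = -2t i and [i, ij] = 2r^2 j. Only
  \<open>r^2\<close> enters, so the coordinates remain polynomials in s = r^2 and t.\<close>

lemma commutator_quat:
  "commutator (quat r t y z w) (quat r t y' z' w') =
     quat r t (- 2 * t * (z * w' - w * z')) (2 * r ^ 2 * (y * w' - w * y'))
       (2 * (y * z' - z * y'))"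
  by (simp add: commutator_def quat_def matrix2_simps algebra_simps power2_eq_square)

abbreviation poly2 :: "'k::field poly poly \<Rightarrow> 'k \<Rightarrow> 'k \<Rightarrow> 'k" where
  "poly2 P s t \<equiv> poly (poly P [:t:]) s"

text \<open>\<open>Y\<close>, \<open>Z\<close>, \<open>W\<close> are chosen before \<open>r\<close>
  and \<open>t\<close>, so an identity in all \<open>r\<close>, \<open>t\<close> constrains them as
  polynomials. The outer variable is t, the inner one s.\<close>

lemma lie_eval_quat:
  fixes y z w :: "nat \<Rightarrow> 'k::field"
  assumes "f \<in> lie_polynomials m"
  shows "\<exists>Y Z W. \<forall>r t. lie_eval (\<lambda>i. quat r t (y i) (z i) (w i)) f =
    quat r t (poly2 Y (r ^ 2) t) (poly2 Z (r ^ 2) t) (poly2 W (r ^ 2) t)"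
    (is "\<exists>Y Z W. \<forall>r t. ?e r t f = ?q Y Z W r t")
  using assms
proof induction
  case (letter i)
  show ?case
    by (rule exI[of _ "[:[:y i:]:]"], rule exI[of _ "[:[:z i:]:]"], rule exI[of _ "[:[:w i:]:]"])
      simp
next
  case zero
  show ?case
    by (intro exI[of _ 0]) (simp add: quat_def matrix2_eq_iff)
next
  case (add u v)
  then obtain Y Z W Y' Z' W' where
    "\<forall>r t. ?e r t u = ?q Y Z W r t" "\<forall>r t. ?e r t v = ?q Y' Z' W' r t"
    by blast
  then show ?case
    by - (rule exI[of _ "Y + Y'"], rule exI[of _ "Z + Z'"], rule exI[of _ "W + W'"],
      simp add: quat_add)
next
  case (scale u c)
  then obtain Y Z W where "\<forall>r t. ?e r t u = ?q Y Z W r t"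
    by blast
  then show ?case
    by - (rule exI[of _ "smult [:c:] Y"], rule exI[of _ "smult [:c:] Z"],
      rule exI[of _ "smult [:c:] W"], simp add: quat_scale)
next
  case (bracket u v)
  then obtain Y Z W Y' Z' W' where
    "\<forall>r t. ?e r t u = ?q Y Z W r t" "\<forall>r t. ?e r t v = ?q Y' Z' W' r t"
    by blast
  then show ?case
    \<comment> \<open>These are the coordinates in \<open>commutator_quat\<close>, with
      \<open>[:0, 1:]\<close> for t and \<open>[:[:0, 1:]:]\<close> for s = r^2.\<close>
    by - (rule exI[of _ "- 2 * [:0, 1:] * (Z * W' - W * Z')"],
      rule exI[of _ "2 * [:[:0, 1:]:] * (Y * W' - W * Y')"],
      rule exI[of _ "2 * (Y * Z' - Z * Y')"], simp add: commutator_quat algebra_simps)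
qed

text \<open>At r = t = 1 the off-diagonal entries are z + w and z - w, so half their sum and half
  their difference recover z and w.\<close>

lemma sl2_eq_quat:
  assumes "(2 :: 'k::field) \<noteq> 0" "A \<in> (sl2 :: ('k^2^2) set)"
  shows "A = quat 1 1 (A$1$1) ((A$1$2 + A$2$1) / 2) ((A$1$2 - A$2$1) / 2)"
proof -
  have half: "x / 2 + x / 2 = x" for x :: 'k
    using assms(1) by (simp add: field_simps)
  have "A$2$2 = - A$1$1"
    using assms(2) by (simp add: sl2_def trace_2 add_eq_0_iff)
  then show ?thesis
    using half[of "A$1$2"] half[of "A$2$1"]
    by (simp add: quat_def matrix2_eq_iff add_divide_distrib diff_divide_distrib algebra_simps)
qed

lemma lie_image_eq_0_if_det_0:
  fixes f :: "'k::alg_closed_field free_lie"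
  assumes two: "(2 :: 'k) \<noteq> 0" and f: "f \<in> lie_polynomials m"
    and det0: "\<And>A. A \<in> lie_image m f \<Longrightarrow> det A = 0"
  shows "lie_image m f = {0}"
proof -
  have "lie_eval a f = 0" if a: "\<forall>i\<in>{1..m}. a i \<in> sl2" for a :: "nat \<Rightarrow> 'k^2^2"
  proof -
    define y z w where "y i = a i $ 1 $ 1" and "z i = (a i $ 1 $ 2 + a i $ 2 $ 1) / 2"
      and "w i = (a i $ 1 $ 2 - a i $ 2 $ 1) / 2" for i
    let ?b = "\<lambda>r t i. quat r t (y i) (z i) (w i)"
    obtain Y Z W where YZW: "\<And>r t. lie_eval (?b r t) f =
        quat r t (poly2 Y (r ^ 2) t) (poly2 Z (r ^ 2) t) (poly2 W (r ^ 2) t)"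
      using lie_eval_quat[OF f, of y z w] by blast
    \<comment> \<open>At s = r^2 this is minus the determinant of the quaternion in
      \<open>YZW\<close>. Every s has such an r, since the field is algebraically closed.\<close>
    let ?N = "smult [:0, 1:] (Y ^ 2) + [:0, 1:] * Z ^ 2 - [:0, 1:] * smult [:0, 1:] (W ^ 2)"
    have "poly2 ?N s t = 0" for s t
    proof -
      obtain r where r: "s = r ^ 2"
        using nth_root_exists[of 2 s] by auto
      have "\<forall>i\<in>{1..m}. ?b r t i \<in> sl2"
        by (simp add: sl2_def quat_def trace_2)
      then have "lie_eval (?b r t) f \<in> lie_image m f"
        unfolding lie_image_def by blast
      then have "det (lie_eval (?b r t) f) = 0"
        by (rule det0)
      then show ?thesis
        unfolding YZW r by (simp add: quat_def det_2) algebra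
    qed
    then have "?N = 0"
      by (rule poly_poly_eq_0[OF infinite_UNIV_alg_closed_field])
    then have "Y = 0 \<and> Z = 0 \<and> W = 0"
      using X_times_square_eq_square by (intro pure_norm_form_anisotropic[of "[:0, 1:]"]) auto
    then have "lie_eval (?b 1 1) f = 0"
      by (simp add: YZW) (simp add: quat_def matrix2_eq_iff)
    \<comment> \<open>Outside \<open>{1..m}\<close> the matrices \<open>a i\<close> need not have
      trace 0, so the two assignments are compared only on \<open>{1..m}\<close>.\<close>
    moreover have "lie_eval a f = lie_eval (?b 1 1) f"
      using sl2_eq_quat[OF two] a by (intro lie_eval_cong[OF f]) (auto simp: y_def z_def w_def)
    ultimately show ?thesis
      by simp
  qed
  then have "lie_image m f \<subseteq> {0}"
    by (auto simp: lie_image_def)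
  then show ?thesis
    using zero_in_lie_image[OF f] by blast
qed

theorem theorem3:
  fixes f :: "'k::alg_closed_field free_lie" and m :: nat
  assumes "CHAR('k) \<noteq> 2"
    and "f \<in> lie_polynomials m"
  shows "lie_image m f = sl2 \<or>
         lie_image m f = {0} \<or>
         lie_image m f = {A. trace A = 0 \<and> \<not> nilpotent_matrix A} \<union> {0}"
proof (cases "\<forall>A\<in>lie_image m f. det A = 0")
  case True
  then show ?thesis
    using lie_image_eq_0_if_det_0[OF two_neq_0[OF assms(1)] assms(2)] by blast
next
  case False
  note two = two_neq_0[OF assms(1)]
  have sub: "trace A = 0" if "A \<in> lie_image m f" for A
    using lie_image_subset_sl2[OF assms(2)] that by (auto simp: sl2_def)
  have similar: "B \<in> lie_image m f"
    if "A \<in> lie_image m f" "A \<noteq> 0" "trace B = 0" "B \<noteq> 0" "det A = det B" for A B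
    using trace_0_similar[OF two sub[OF that(1)] that(2-5)] lie_image_conjugate[OF assms(2) that(1)]
    by metis
  have zero: "0 \<in> lie_image m f"
    by (rule zero_in_lie_image[OF assms(2)])
  have nonnilp: "B \<in> lie_image m f" if "trace B = 0" "det B \<noteq> 0" for B
  proof -
    obtain A where "A \<in> lie_image m f" "det A = det B"
      using False det_surj_on_lie_image[OF assms(2)] by metis
    then show ?thesis
      using that similar[of A B] by (metis det_0 mat_0)
  qed
  show ?thesis
  \<comment> \<open>All non-nilpotent trace zero matrices are already values; one nonzero nilpotent
    value brings in all the others by conjugation.\<close>
  proof (cases "\<exists>A\<in>lie_image m f. A \<noteq> 0 \<and> det A = 0")
    case True
    then have "B \<in> lie_image m f" if "trace B = 0" for B
      using that similar nonnilp zero by metis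
    then have "lie_image m f = sl2"
      using sub by (auto simp: sl2_def)
    then show ?thesis
      by blast
  next
    case False
    then have "lie_image m f = {A. trace A = 0 \<and> \<not> nilpotent_matrix A} \<union> {0}"
      using sub zero nonnilp by (auto simp: nilpotent_matrix_iff_det)
    then show ?thesis
      by blast
  qed
qed

end
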